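(* Let $a,b>0$ be real with $a\neq b$, let $r,k$ be nonnegative integers, let $\bar\alpha_r=(\alpha_0,\dots,\alpha_{r-1})$ be a sequence of complex numbers with $\alpha_i\neq 1$ for all $i$, and let $x,y\in\mathbb{R}$. Then for every integer $n\ge 0$, $${}_{p}\mathbb{M}_{n}^{(r)}(x+1,y;k,a,b;\bar\alpha_{r})=\sum_{m=0}^{n}\binom{n}{m}\,{}_{p}\mathbb{M}_{n-m}^{(r)}(x,y;k,a,b;\bar\alpha_{r}).$$
   Context: All generating functions are understood as formal power series in $t$ (with $b^t=e^{t\log b}$, $a^t=e^{t\log a}$). Fix a family of functions $\varphi_n(y)$ and the series $\varphi(y,t)=\sum_{n\ge0}\varphi_n(y)\frac{t^n}{n!}$ with $\varphi_0(y)\neq0$. The 2-variable general polynomials $p_n(x,y)$ are defined by $e^{xt}\varphi(y,t)=\sum_{n\ge 0}p_n(x,y)\frac{t^n}{n!}$, with $p_0(x,y)=1$. The 2-variable unified family ${}_{p}\mathbb{M}_{n}^{(r)}(x,y;k,a,b;\bar\alpha_r)$ of generalized Apostol-Euler, Bernoulli and Genocchi polynomials of order $r$ is defined by $$\sum_{n=0}^{\infty}{}_{p}\mathbb{M}_{n}^{(r)}(x,y;k,a,b;\bar\alpha_{r})\frac{t^{n}}{n!}=\frac{(-1)^{r}t^{rk}2^{r(1-k)}}{\prod_{i=0}^{r-1}(\alpha_{i}b^{t}-a^{t})}\,e^{xt}\varphi(y,t).$$ The left subscript $p$ is only a label referring to the family $p_n(x,y)$. *)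

theory Defs
  imports Complex_Main "HOL-Computational_Algebra.Formal_Power_Series"
begin

definition egf :: "(nat \<Rightarrow> complex) \<Rightarrow> complex fps" where
  "egf c = Abs_fps (\<lambda>n. c n / fact n)"

definition egf_coeff :: "complex fps \<Rightarrow> nat \<Rightarrow> complex" where
  "egf_coeff F n = fact n * fps_nth F n"

lemma egf_egf_coeff: "egf (egf_coeff F) = F"
  by (simp add: egf_def egf_coeff_def fps_eq_iff)

text \<open>The formal series \<open>b\<^sup>t = exp (t log b)\<close> of a real base \<open>b > 0\<close>.\<close>

definition fps_base_exp :: "real \<Rightarrow> complex fps" where
  "fps_base_exp b = fps_exp (of_real (ln b))"

definition gen_poly_series :: "(nat \<Rightarrow> real \<Rightarrow> complex) \<Rightarrow> real \<Rightarrow> real \<Rightarrow> complex fps" where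
  "gen_poly_series \<phi> x y = fps_exp (of_real x) * egf (\<lambda>n. \<phi> n y)"

text \<open>The 2-variable general polynomials \<open>p\<^sub>n(x, y)\<close> attached to the family \<open>\<phi>\<close>.\<close>

definition gen_poly :: "(nat \<Rightarrow> real \<Rightarrow> complex) \<Rightarrow> nat \<Rightarrow> real \<Rightarrow> real \<Rightarrow> complex" where
  "gen_poly \<phi> n x y = egf_coeff (gen_poly_series \<phi> x y) n"

text \<open>
  The unified Apostol-type family of order \<open>r\<close>; only \<open>\<alpha> 0, \<dots>, \<alpha> (r - 1)\<close> matter. The constant
  term of the denominator is the product of the \<open>\<alpha> i - 1\<close>, so for \<open>\<alpha> i \<noteq> 1\<close> the division is
  multiplication by the inverse power series. The exponent \<open>r (1 - k)\<close> of 2 may be negative.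
\<close>

definition apostol_series ::
  "(nat \<Rightarrow> real \<Rightarrow> complex) \<Rightarrow> nat \<Rightarrow> real \<Rightarrow> real \<Rightarrow> nat \<Rightarrow> real \<Rightarrow> real \<Rightarrow> (nat \<Rightarrow> complex) \<Rightarrow> complex fps"
where
  "apostol_series \<phi> r x y k a b \<alpha> =
     ((-1) ^ r * fps_X ^ (r * k) * fps_const (2 powi (int r * (1 - int k)))) /
     (\<Prod>i<r. fps_const (\<alpha> i) * fps_base_exp b - fps_base_exp a)
     * fps_exp (of_real x) * egf (\<lambda>n. \<phi> n y)"

definition apostol_poly ::
  "(nat \<Rightarrow> real \<Rightarrow> complex) \<Rightarrow> nat \<Rightarrow> nat \<Rightarrow> real \<Rightarrow> real \<Rightarrow> nat \<Rightarrow> real \<Rightarrow> real \<Rightarrow> (nat \<Rightarrow> complex) \<Rightarrow> complex"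
where
  "apostol_poly \<phi> r n x y k a b \<alpha> = egf_coeff (apostol_series \<phi> r x y k a b \<alpha>) n"

end

theory Submission
  imports Defs
begin

text \<open>
  The variable \<open>x\<close> enters the generating function only through the factor \<open>exp (x t)\<close>, so
  replacing \<open>x\<close> by \<open>x + 1\<close> multiplies the whole series by \<open>exp t\<close>
  (\<open>apostol_series_shift\<close>). For exponential generating functions, multiplication by \<open>exp t\<close> is
  the binomial transform of the coefficients (\<open>egf_coeff_exp_mult\<close>), since every egf-coefficient
  of \<open>exp t\<close> is 1. Comparing coefficients gives the identity.
\<close>

text \<open>
  Multiplying two power series convolves their ordinary coefficients; the factor \<open>fact n\<close> turns the
  weights \<open>1 / fact m\<close> of \<open>exp t\<close> into binomial coefficients.
\<close>

lemma egf_coeff_exp_mult: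
  "egf_coeff (fps_exp 1 * F) n = (\<Sum>m=0..n. of_nat (n choose m) * egf_coeff F (n - m))"
proof -
  have "egf_coeff (fps_exp 1 * F) n = (\<Sum>m=0..n. fact n * (1 / fact m * fps_nth F (n - m)))"
    by (simp add: egf_coeff_def fps_mult_nth sum_distrib_left)
  also have "\<dots> = (\<Sum>m=0..n. of_nat (n choose m) * egf_coeff F (n - m))"
    by (intro sum.cong) (simp_all add: egf_coeff_def binomial_fact)
  finally show ?thesis .
qed

text \<open>
  This is the addition law of the exponential, \<open>exp ((x + 1) t) = exp t * exp (x t)\<close>; the quotient in
  front of it depends on \<open>\<alpha>\<close>, \<open>a\<close>, \<open>b\<close>, \<open>k\<close> and \<open>r\<close> alone and is carried along unchanged.
\<close>

lemma apostol_series_shift: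
  "apostol_series \<phi> r (x + 1) y k a b \<alpha> = fps_exp 1 * apostol_series \<phi> r x y k a b \<alpha>"
  by (simp add: apostol_series_def fps_exp_add_mult mult_ac)

theorem theorem3p4:
  fixes \<phi> :: "nat \<Rightarrow> real \<Rightarrow> complex" and \<alpha> :: "nat \<Rightarrow> complex"
    and a b x y :: real and r k n :: nat
  assumes "\<And>y. \<phi> 0 y \<noteq> 0"
    and "\<And>x y. gen_poly \<phi> 0 x y = 1"
    and "a > 0" and "b > 0" and "a \<noteq> b"
    and "\<And>i. i < r \<Longrightarrow> \<alpha> i \<noteq> 1"
  shows "apostol_poly \<phi> r n (x + 1) y k a b \<alpha> =
    (\<Sum>m=0..n. of_nat (n choose m) * apostol_poly \<phi> r (n - m) x y k a b \<alpha>)"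
  by (simp add: apostol_poly_def apostol_series_shift egf_coeff_exp_mult)

end
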